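(* Let $A\in\mathbb{C}^{n\times n}$ and $1\le k\le n$. Then $$\|A\|_{(k)}=\max_{Q\in \mathbf{U}(n)}\|AQ\|^{\delta}_{(k)}.$$
   Context: $n\ge 2$. $\mathbf{U}(n)$ is the set of $n\times n$ unitary matrices. $\|A\|_{(k)}=\sum_{i=1}^k\sigma_i(A)$ is the $k$-th Ky-Fan norm, where $\sigma_1(A)\ge\dots\ge\sigma_n(A)$ are the singular values of $A$. For $A\in\mathbb{C}^{n\times n}$ and $1\le k\le n$ the $k$-th discrepancy seminorm is $$\|A\|^{\delta}_{(k)}=\max\Big|\sum_{i=1}^k\langle Ax_i,y_i\rangle\Big|,$$ the maximum being over all pairs of orthonormal families $\{x_j\}_{j=1}^k$, $\{y_j\}_{j=1}^k$ in $\mathbb{C}^n$ with $\sum_{j=1}^k\langle x_j,y_j\rangle=0$. *)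

theory Defs
  imports
    "Jordan_Normal_Form.Schur_Decomposition"
    "Jordan_Normal_Form.Char_Poly"
    "HOL-Computational_Algebra.Polynomial"
    "HOL-Computational_Algebra.Fundamental_Theorem_Algebra"
begin

definition unitary_group :: "nat \<Rightarrow> complex mat set" where
  "unitary_group n =
    {Q \<in> carrier_mat n n. mat_adjoint Q * Q = 1\<^sub>m n \<and> Q * mat_adjoint Q = 1\<^sub>m n}"

text \<open>
  Decreasing list of the singular values with multiplicity: square roots of the eigenvalues of
  \<open>A\<^sup>* A\<close>, i.e. of the roots of its characteristic polynomial. These roots are real and
  nonnegative, so \<open>Re\<close> is only a change of type. The list is indexed from 0.
\<close>

definition singular_values :: "complex mat \<Rightarrow> real list" where
  "singular_values A = rev (sorted_list_of_multiset
    (image_mset (\<lambda>z. sqrt (Re z)) (proots (char_poly (mat_adjoint A * A)))))"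

definition ky_fan_norm :: "nat \<Rightarrow> complex mat \<Rightarrow> real" where
  "ky_fan_norm k A = (\<Sum>i<k. singular_values A ! i)"

definition orthonormal_family :: "nat \<Rightarrow> nat \<Rightarrow> (nat \<Rightarrow> complex vec) \<Rightarrow> bool" where
  "orthonormal_family n k x \<longleftrightarrow>
    (\<forall>i<k. x i \<in> carrier_vec n) \<and>
    (\<forall>i<k. \<forall>j<k. x i \<bullet>c x j = (if i = j then 1 else 0))"

text \<open>
  The inner product \<open>\<bullet>c\<close> is linear in its first argument and conjugate-linear in the second.
  \<open>GREATEST\<close> is a genuine maximum: it only has a determined value if the maximum is attained.
\<close>

definition discrepancy_seminorm :: "nat \<Rightarrow> complex mat \<Rightarrow> real" where
  "discrepancy_seminorm k A = (GREATEST r. \<exists>x y.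
      orthonormal_family (dim_row A) k x \<and> orthonormal_family (dim_row A) k y \<and>
      (\<Sum>j<k. x j \<bullet>c y j) = 0 \<and>
      r = cmod (\<Sum>j<k. (A *\<^sub>v x j) \<bullet>c y j))"

definition is_maximum :: "real set \<Rightarrow> real \<Rightarrow> bool" where
  "is_maximum S m \<longleftrightarrow> m \<in> S \<and> (\<forall>s\<in>S. s \<le> m)"

end

theory Submission
  imports Defs "Jordan_Normal_Form.Spectral_Radius" "HOL-Analysis.Function_Topology"
begin

text \<open>
  For a singular value decomposition \<open>A v\<^sub>i = \<sigma>\<^sub>i u\<^sub>i\<close>, Parseval's identity and the inequality of the
  means bound \<open>\<bar>\<Sum>i<k. \<langle>A x\<^sub>i, y\<^sub>i\<rangle>\<bar>\<close> by \<open>\<Sum>l. \<sigma>\<^sub>l d\<^sub>l\<close> with weights in \<open>[0, 1]\<close> of total at most \<open>k\<close>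
  (Bessel), hence by the sum of the \<open>k\<close> largest singular values. This applies to \<open>A Q\<close>, since \<open>Q\<close>
  only replaces the family \<open>x\<close> by another orthonormal family. For equality, let \<open>Q\<close> map the cyclic
  shift \<open>u\<^sub>i\<^sub>+\<^sub>1\<close> of the basis to \<open>v\<^sub>i\<close>: the families \<open>x\<^sub>i = u\<^sub>i\<^sub>+\<^sub>1\<close> and \<open>y\<^sub>i = u\<^sub>i\<close> satisfy
  \<open>\<langle>x\<^sub>i, y\<^sub>i\<rangle> = 0\<close> (here \<open>n \<ge> 2\<close> enters) and \<open>\<langle>A Q x\<^sub>i, y\<^sub>i\<rangle> = \<sigma>\<^sub>i\<close>.
\<close>

section \<open>Orthonormal families\<close>

lemma cinner_eq_sum:
  assumes "x \<in> carrier_vec n" "y \<in> carrier_vec n"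
  shows "x \<bullet>c y = (\<Sum>a<n. x $ a * cnj (y $ a))"
  using assms by (auto simp: scalar_prod_def lessThan_atLeast0 intro!: sum.cong)

lemma cinner_commute:
  assumes "x \<in> carrier_vec n" "y \<in> carrier_vec n"
  shows "y \<bullet>c x = cnj (x \<bullet>c y)"
  using assms by (simp add: cinner_eq_sum[of _ n] mult.commute)

lemma cinner_self:
  assumes "x \<in> carrier_vec n"
  shows "x \<bullet>c x = complex_of_real (\<Sum>a<n. (cmod (x $ a))\<^sup>2)"
  using assms by (simp add: cinner_eq_sum[of _ n] complex_norm_square del: of_real_power)

lemma cinner_smult_left:
  assumes "x \<in> carrier_vec n" "y \<in> carrier_vec n"
  shows "(c \<cdot>\<^sub>v x) \<bullet>c y = c * (x \<bullet>c y)"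
  using assms by (simp add: cinner_eq_sum[of _ n] sum_distrib_left mult.assoc)

lemma cinner_smult_right:
  assumes "x \<in> carrier_vec n" "y \<in> carrier_vec n"
  shows "x \<bullet>c (c \<cdot>\<^sub>v y) = cnj c * (x \<bullet>c y)"
  using assms by (simp add: cinner_eq_sum[of _ n] sum_distrib_left algebra_simps)

lemma cinner_unit_vec:
  fixes x :: "complex vec"
  assumes "x \<in> carrier_vec n" "a < n"
  shows "x \<bullet>c unit_vec n a = x $ a"
proof -
  have "x \<bullet>c unit_vec n a = (\<Sum>b<n. x $ b * (if b = a then 1 else 0))"
    using assms by (subst cinner_eq_sum[of _ n]) (auto simp: unit_vec_def intro!: sum.cong)
  also have "\<dots> = (\<Sum>b<n. if b = a then x $ b else 0)" by (intro sum.cong) auto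
  finally show ?thesis using assms by simp
qed

lemma orthonormal_familyD:
  assumes "orthonormal_family n k x"
  shows "i < k \<Longrightarrow> x i \<in> carrier_vec n"
    and "i < k \<Longrightarrow> j < k \<Longrightarrow> x i \<bullet>c x j = (if i = j then 1 else 0)"
  using assms unfolding orthonormal_family_def by auto

lemma mat_adjoint_carrier: "A \<in> carrier_mat n m \<Longrightarrow> mat_adjoint A \<in> carrier_mat m n"
  unfolding mat_adjoint_def by auto

lemma mat_adjoint_index:
  fixes A :: "complex mat"
  assumes "A \<in> carrier_mat n m" "i < m" "j < n"
  shows "mat_adjoint A $$ (i, j) = cnj (A $$ (j, i))"
  using assms unfolding mat_adjoint_def by (auto simp: mat_of_rows_index)

lemma mat_adjoint_adjoint:
  fixes A :: "complex mat"
  assumes "A \<in> carrier_mat n m"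
  shows "mat_adjoint (mat_adjoint A) = A"
proof (rule eq_matI)
  have "mat_adjoint A \<in> carrier_mat m n" using assms by (rule mat_adjoint_carrier)
  then show "\<And>i j. i < dim_row A \<Longrightarrow> j < dim_col A \<Longrightarrow> mat_adjoint (mat_adjoint A) $$ (i, j) = A $$ (i, j)"
    using assms by (simp add: mat_adjoint_index[of _ m n] mat_adjoint_index[of _ n m])
  show "dim_row (mat_adjoint (mat_adjoint A)) = dim_row A" "dim_col (mat_adjoint (mat_adjoint A)) = dim_col A"
    using mat_adjoint_carrier[OF mat_adjoint_carrier[OF assms]] assms by auto
qed

lemma cinner_mat_adjoint:
  fixes A :: "complex mat"
  assumes A: "A \<in> carrier_mat n n" and x: "x \<in> carrier_vec n" and y: "y \<in> carrier_vec n"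
  shows "(A *\<^sub>v x) \<bullet>c y = x \<bullet>c (mat_adjoint A *\<^sub>v y)"
proof -
  have A': "mat_adjoint A \<in> carrier_mat n n" by (rule mat_adjoint_carrier[OF A])
  have "(A *\<^sub>v x) \<bullet>c y = (\<Sum>a<n. (\<Sum>b<n. A $$ (a, b) * x $ b) * cnj (y $ a))"
    using A x y by (auto simp: cinner_eq_sum[of _ n] scalar_prod_def lessThan_atLeast0 intro!: sum.cong)
  also have "\<dots> = (\<Sum>b<n. \<Sum>a<n. A $$ (a, b) * x $ b * cnj (y $ a))"
    by (subst sum.swap) (simp add: sum_distrib_right)
  also have "\<dots> = (\<Sum>b<n. x $ b * cnj (\<Sum>a<n. mat_adjoint A $$ (b, a) * y $ a))"
    by (simp add: sum_distrib_left mat_adjoint_index[OF A] algebra_simps)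
  also have "\<dots> = x \<bullet>c (mat_adjoint A *\<^sub>v y)"
    using A' x y by (auto simp: cinner_eq_sum[of _ n] scalar_prod_def lessThan_atLeast0 intro!: sum.cong)
  finally show ?thesis .
qed

text \<open>The entries of \<open>mat_adjoint V * V\<close> are the inner products of the columns,
  and a left inverse of a square matrix is also a right inverse.\<close>

lemma unitary_group_columns:
  assumes "orthonormal_family n n v"
  shows "mat n n (\<lambda>(a, l). v l $ a) \<in> unitary_group n"
proof -
  let ?V = "mat n n (\<lambda>(a, l). v l $ a)"
  have V: "?V \<in> carrier_mat n n" by simp
  note V' = mat_adjoint_carrier[OF V]
  note v = orthonormal_familyD[OF assms]
  have "mat_adjoint ?V * ?V = 1\<^sub>m n"
  proof (rule eq_matI)
    fix i j assume "i < dim_row (1\<^sub>m n)" "j < dim_col (1\<^sub>m n)"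
    then have i: "i < n" and j: "j < n" by auto
    have "(mat_adjoint ?V * ?V) $$ (i, j) = (\<Sum>a<n. cnj (v i $ a) * v j $ a)"
      using V V' i j by (auto simp: scalar_prod_def mat_adjoint_index[OF V] lessThan_atLeast0 intro!: sum.cong)
    also have "\<dots> = v j \<bullet>c v i"
      using v i j by (simp add: cinner_eq_sum[of _ n] mult.commute)
    finally show "(mat_adjoint ?V * ?V) $$ (i, j) = 1\<^sub>m n $$ (i, j)"
      using v i j by simp
  qed (use V' in auto)
  then show ?thesis
    using mat_mult_left_right_inverse[OF V' V] V unfolding unitary_group_def by simp
qed

text \<open>Expanding the right-hand side and summing over \<open>l\<close> first leaves the entries
  of \<open>V * mat_adjoint V\<close>, which is the identity because the rows of \<open>V\<close>
  are orthonormal as well.\<close>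

lemma parseval:
  assumes v: "orthonormal_family n n v" and x: "x \<in> carrier_vec n" and y: "y \<in> carrier_vec n"
  shows "x \<bullet>c y = (\<Sum>l<n. (x \<bullet>c v l) * (v l \<bullet>c y))"
proof -
  let ?V = "mat n n (\<lambda>(a, l). v l $ a)"
  have V: "?V \<in> carrier_mat n n" by simp
  note V' = mat_adjoint_carrier[OF V]
  have VV: "?V * mat_adjoint ?V = 1\<^sub>m n"
    using unitary_group_columns[OF v] unfolding unitary_group_def by simp
  have *: "(\<Sum>l<n. v l $ b * cnj (v l $ a)) = (if a = b then 1 else 0)" if "a < n" "b < n" for a b
  proof -
    have "(\<Sum>l<n. v l $ b * cnj (v l $ a)) = (?V * mat_adjoint ?V) $$ (b, a)"
      using that V V' by (auto simp: scalar_prod_def mat_adjoint_index[OF V] lessThan_atLeast0 intro!: sum.cong)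
    then show ?thesis using that unfolding VV by auto
  qed
  have "(\<Sum>l<n. (x \<bullet>c v l) * (v l \<bullet>c y))
      = (\<Sum>l<n. \<Sum>a<n. \<Sum>b<n. x $ a * cnj (y $ b) * (v l $ b * cnj (v l $ a)))"
    using orthonormal_familyD(1)[OF v] x y
    by (auto simp: cinner_eq_sum[of _ n] sum_product algebra_simps intro!: sum.cong)
  also have "\<dots> = (\<Sum>a<n. \<Sum>l<n. \<Sum>b<n. x $ a * cnj (y $ b) * (v l $ b * cnj (v l $ a)))"
    by (rule sum.swap)
  also have "\<dots> = (\<Sum>a<n. \<Sum>b<n. \<Sum>l<n. x $ a * cnj (y $ b) * (v l $ b * cnj (v l $ a)))"
    by (rule sum.cong[OF refl], rule sum.swap)
  also have "\<dots> = (\<Sum>a<n. \<Sum>b<n. x $ a * cnj (y $ b) * (if a = b then 1 else 0))"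
    using * by (simp add: sum_distrib_left[symmetric])
  also have "\<dots> = (\<Sum>a<n. \<Sum>b<n. if a = b then x $ a * cnj (y $ b) else 0)"
    by (intro sum.cong refl) auto
  also have "\<dots> = x \<bullet>c y" using x y by (simp add: cinner_eq_sum[of _ n])
  finally show ?thesis by simp
qed

text \<open>Coordinates are inner products with standard unit vectors, and by
  \<open>parseval\<close> these depend only on the coefficients along \<open>v\<close>.\<close>

lemma orthonormal_basis_eqI:
  assumes v: "orthonormal_family n n v" and x: "x \<in> carrier_vec n" and y: "y \<in> carrier_vec n"
    and eq: "\<And>l. l < n \<Longrightarrow> x \<bullet>c v l = y \<bullet>c v l"
  shows "x = y"
proof (rule eq_vecI)
  fix a assume "a < dim_vec y"
  then have a: "a < n" using y by simp
  have "x \<bullet>c unit_vec n a = y \<bullet>c unit_vec n a"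
    using parseval[OF v x, of "unit_vec n a"] parseval[OF v y, of "unit_vec n a"] eq by simp
  then show "x $ a = y $ a" using cinner_unit_vec x y a by metis
qed (use x y in auto)

text \<open>Only the scalar is returned, so that linear relations known for \<open>x\<close> carry
  over to its normalization.\<close>

lemma normalize_vec:
  assumes x: "x \<in> carrier_vec n" and "x \<noteq> 0\<^sub>v n"
  obtains c :: complex where "(c \<cdot>\<^sub>v x) \<bullet>c (c \<cdot>\<^sub>v x) = 1"
proof -
  define s where "s = (\<Sum>a<n. (cmod (x $ a))\<^sup>2)"
  have xx: "x \<bullet>c x = complex_of_real s" unfolding s_def by (rule cinner_self[OF x])
  have "x \<bullet>c x \<noteq> 0" using assms by simp
  then have "s \<noteq> 0" using xx by auto
  moreover have "s \<ge> 0" unfolding s_def by (intro sum_nonneg) simp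
  ultimately have "s > 0" by simp
  let ?c = "complex_of_real (1 / sqrt s)"
  have "(?c \<cdot>\<^sub>v x) \<bullet>c (?c \<cdot>\<^sub>v x) = ?c * (cnj ?c * (x \<bullet>c x))"
    using x by (simp add: cinner_smult_left[of _ n] cinner_smult_right[of _ n])
  also have "\<dots> = complex_of_real (1 / sqrt s * (1 / sqrt s * s))"
    unfolding xx by (simp only: complex_cnj_complex_of_real of_real_mult)
  also have "1 / sqrt s * (1 / sqrt s * s) = 1" using \<open>s > 0\<close> by (simp add: field_simps)
  finally show ?thesis using that by (simp only: of_real_1)
qed

lemma orthonormal_family_snoc:
  assumes v: "orthonormal_family n r v" and w: "w \<in> carrier_vec n" "w \<bullet>c w = 1"
    and ortho: "\<And>i. i < r \<Longrightarrow> w \<bullet>c v i = 0"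
  shows "orthonormal_family n (Suc r) (v(r := w))"
proof -
  have "v i \<bullet>c w = 0" if "i < r" for i
    using cinner_commute[OF w(1) orthonormal_familyD(1)[OF v that]] ortho[OF that] by simp
  then show ?thesis
    using v w ortho unfolding orthonormal_family_def by (auto simp: less_Suc_eq)
qed

text \<open>A singular matrix has a nonzero kernel vector. If its rows are the conjugates of the
  \<open>v i\<close>, padded with zero rows, then a kernel vector is orthogonal to every
  \<open>v i\<close>.\<close>

lemma exists_unit_orthogonal:
  assumes v: "orthonormal_family n r v" and r: "r < n"
  obtains w where "w \<in> carrier_vec n" "w \<bullet>c w = 1" "\<And>i. i < r \<Longrightarrow> w \<bullet>c v i = 0"
proof -
  let ?M = "mat n n (\<lambda>(i, a). if i < r then cnj (v i $ a) else 0)"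
  have M: "?M \<in> carrier_mat n n" by simp
  \<comment> \<open>Since \<open>r < n\<close>, row \<open>r\<close> is one of the zero rows; this
    is the form that \<open>det_row_0\<close> expects.\<close>
  have "?M = mat\<^sub>r n n (\<lambda>i. if i = r then 0\<^sub>v n else row ?M i)"
    using r by (intro eq_matI) auto
  then have "det ?M = 0"
    using det_row_0[OF r, of "\<lambda>i. row ?M i"] M by auto
  then obtain x where x: "x \<in> carrier_vec n" "x \<noteq> 0\<^sub>v n" and Mx: "?M *\<^sub>v x = 0\<^sub>v n"
    using det_0_iff_vec_prod_zero_field[OF M] by auto
  obtain c where c: "(c \<cdot>\<^sub>v x) \<bullet>c (c \<cdot>\<^sub>v x) = 1" using normalize_vec[OF x] by auto
  have "x \<bullet>c v i = 0" if i: "i < r" for i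
  proof -
    have "x \<bullet>c v i = (\<Sum>a<n. cnj (v i $ a) * x $ a)"
      using x orthonormal_familyD(1)[OF v i] by (simp add: cinner_eq_sum[of _ n] mult.commute)
    also have "\<dots> = (?M *\<^sub>v x) $ i"
      using i r x by (auto simp: scalar_prod_def lessThan_atLeast0 intro!: sum.cong)
    finally show ?thesis using Mx i r by simp
  qed
  then show ?thesis
    using that[of "c \<cdot>\<^sub>v x"] c x orthonormal_familyD(1)[OF v] by (simp add: cinner_smult_left[of _ n])
qed

lemma orthonormal_completion:
  assumes "orthonormal_family n r v" and "r \<le> n"
  obtains w where "orthonormal_family n n w" "\<And>i. i < r \<Longrightarrow> w i = v i"
proof -
  have "\<exists>w. orthonormal_family n n w \<and> (\<forall>i<r. w i = v i)"
    using assms(2,1)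
  proof (induction arbitrary: v rule: inc_induct)
    \<comment> \<open>\<open>inc_induct\<close> descends from \<open>n\<close>: a family of length
      \<open>m\<close> gains one vector and is then completed by the hypothesis for
      \<open>Suc m\<close>.\<close>
    case (step m)
    obtain w where w: "w \<in> carrier_vec n" "w \<bullet>c w = 1" "\<And>i. i < m \<Longrightarrow> w \<bullet>c v i = 0"
      using exists_unit_orthogonal[OF step.prems step.hyps(2)] by metis
    obtain u where "orthonormal_family n n u" "\<forall>i<Suc m. u i = (v(m := w)) i"
      using step.IH[OF orthonormal_family_snoc[OF step.prems w]] by blast
    then show ?case by (intro exI[of _ u]) auto
  qed auto
  then show ?thesis using that by blast
qed

text \<open>Once \<open>v\<close> is extended to a basis, the sum is part of the Parseval sum, which
  equals 1.\<close>

lemma bessel: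
  assumes v: "orthonormal_family n k v" "k \<le> n" and x: "x \<in> carrier_vec n" "x \<bullet>c x = 1"
  shows "(\<Sum>i<k. (cmod (x \<bullet>c v i))\<^sup>2) \<le> 1"
proof -
  obtain w where w: "orthonormal_family n n w" and eq: "\<And>i. i < k \<Longrightarrow> w i = v i"
    using orthonormal_completion[OF v] by metis
  have "(\<Sum>l<n. (x \<bullet>c w l) * (w l \<bullet>c x)) = 1" using parseval[OF w x(1) x(1)] x(2) by simp
  also have "(\<Sum>l<n. (x \<bullet>c w l) * (w l \<bullet>c x)) = complex_of_real (\<Sum>l<n. (cmod (x \<bullet>c w l))\<^sup>2)"
    unfolding of_real_sum
    using cinner_commute[OF x(1) orthonormal_familyD(1)[OF w]]
    by (intro sum.cong) (simp_all only: complex_norm_square lessThan_iff)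
  finally have "(\<Sum>l<n. (cmod (x \<bullet>c w l))\<^sup>2) = 1" by (metis of_real_eq_1_iff)
  moreover have "(\<Sum>i<k. (cmod (x \<bullet>c v i))\<^sup>2) \<le> (\<Sum>l<n. (cmod (x \<bullet>c w l))\<^sup>2)"
  proof -
    have "(\<Sum>i<k. (cmod (x \<bullet>c v i))\<^sup>2) = (\<Sum>i<k. (cmod (x \<bullet>c w i))\<^sup>2)" using eq by simp
    also have "\<dots> \<le> (\<Sum>l<n. (cmod (x \<bullet>c w l))\<^sup>2)" using v(2) by (intro sum_mono2) auto
    finally show ?thesis .
  qed
  ultimately show ?thesis by simp
qed

section \<open>Singular value decomposition\<close>

text \<open>The orthogonal complement of known eigenvectors is invariant under a Hermitian map, so
  an eigenvector of the compression to it, which exists over the complex numbers, is an eigenvector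
  of \<open>H\<close>.\<close>

lemma hermitian_next_eigenvector:
  assumes H: "H \<in> carrier_mat n n"
    and herm: "\<And>x y. x \<in> carrier_vec n \<Longrightarrow> y \<in> carrier_vec n \<Longrightarrow> (H *\<^sub>v x) \<bullet>c y = x \<bullet>c (H *\<^sub>v y)"
    and v: "orthonormal_family n r v" and r: "r < n"
    and eig: "\<And>i. i < r \<Longrightarrow> H *\<^sub>v v i = \<mu> i \<cdot>\<^sub>v v i"
  obtains w c where "w \<in> carrier_vec n" "w \<bullet>c w = 1" "\<And>i. i < r \<Longrightarrow> w \<bullet>c v i = 0"
    "H *\<^sub>v w = c \<cdot>\<^sub>v w"
proof -
  obtain b where b: "orthonormal_family n n b" and bv: "\<And>i. i < r \<Longrightarrow> b i = v i"
    using orthonormal_completion[OF v] r by auto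
  note bc = orthonormal_familyD(1)[OF b] and bb = orthonormal_familyD(2)[OF b]
  have Hc: "H *\<^sub>v x \<in> carrier_vec n" if "x \<in> carrier_vec n" for x using H that by simp
  define m where "m = n - r"
  have m: "m > 0" "\<And>j. j < m \<Longrightarrow> r + j < n" unfolding m_def using r by auto
  \<comment> \<open>the compression of \<open>H\<close> to the orthogonal complement of the eigenvectors found so far\<close>
  define M where "M = mat m m (\<lambda>(i, j). (H *\<^sub>v b (r + j)) \<bullet>c b (r + i))"
  have M: "M \<in> carrier_mat m m" unfolding M_def by simp
  obtain c where "eigenvalue M c"
    using spectrum_non_empty[OF M m(1)] unfolding spectrum_def by auto
  then obtain u where u: "u \<in> carrier_vec m" "u \<noteq> 0\<^sub>v m" and Mu: "M *\<^sub>v u = c \<cdot>\<^sub>v u"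
    using M unfolding eigenvalue_def eigenvector_def by auto
  \<comment> \<open>\<open>x\<close> has the coefficients \<open>u\<close> along \<open>b r\<close>,
    ..., \<open>b (n - 1)\<close> and none along the eigenvectors \<open>v i\<close>;
    \<open>x_high\<close> and \<open>x_low\<close> confirm this.\<close>
  define x where "x = vec n (\<lambda>a. \<Sum>j<m. u $ j * b (r + j) $ a)"
  have x: "x \<in> carrier_vec n" unfolding x_def by simp
  have xy: "x \<bullet>c y = (\<Sum>j<m. u $ j * (b (r + j) \<bullet>c y))" if y: "y \<in> carrier_vec n" for y
  proof -
    have "x \<bullet>c y = (\<Sum>a<n. \<Sum>j<m. u $ j * (b (r + j) $ a * cnj (y $ a)))"
      unfolding cinner_eq_sum[OF x y] by (simp add: x_def sum_distrib_right mult.assoc)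
    also have "\<dots> = (\<Sum>j<m. u $ j * (b (r + j) \<bullet>c y))"
      by (subst sum.swap) (simp add: cinner_eq_sum[OF bc[OF m(2)] y] sum_distrib_left)
    finally show ?thesis .
  qed
  have x_high: "x \<bullet>c b (r + i) = u $ i" if i: "i < m" for i
  proof -
    have "x \<bullet>c b (r + i) = (\<Sum>j<m. if j = i then u $ j else 0)"
      unfolding xy[OF bc[OF m(2)[OF i]]] using i by (intro sum.cong) (auto simp: bb m(2))
    then show ?thesis using i by simp
  qed
  have x_low: "x \<bullet>c b i = 0" if i: "i < r" for i
    using i r by (subst xy) (auto intro!: sum.neutral simp: bc bb m(2))
  have Hx: "H *\<^sub>v x = c \<cdot>\<^sub>v x"
  proof (rule orthonormal_basis_eqI[OF b])
    show "H *\<^sub>v x \<in> carrier_vec n" "c \<cdot>\<^sub>v x \<in> carrier_vec n" using x Hc by auto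
    fix l assume l: "l < n"
    have R: "(c \<cdot>\<^sub>v x) \<bullet>c b l = c * (x \<bullet>c b l)" by (rule cinner_smult_left[OF x bc[OF l]])
    have L: "(H *\<^sub>v x) \<bullet>c b l = x \<bullet>c (H *\<^sub>v b l)" by (rule herm[OF x bc[OF l]])
    show "(H *\<^sub>v x) \<bullet>c b l = (c \<cdot>\<^sub>v x) \<bullet>c b l"
    proof (cases "l < r")
      case True
      \<comment> \<open>Both sides of the goal vanish: \<open>H\<close> only scales
        \<open>b l\<close>, and \<open>x\<close> is orthogonal to it. This is the invariance of the
        complement.\<close>
      then have "x \<bullet>c (H *\<^sub>v b l) = cnj (\<mu> l) * (x \<bullet>c b l)"
        using eig[OF True] cinner_smult_right[OF x bc[OF l]] bv by simp
      then show ?thesis unfolding L R using x_low[OF True] by simp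
    next
      case False
      define i where "i = l - r"
      have i: "i < m" "l = r + i" unfolding i_def m_def using False l by auto
      \<comment> \<open>Moving \<open>H\<close> back onto the basis vectors in the expansion of
        \<open>x\<close> produces row \<open>i\<close> of \<open>M\<close>, so the eigenvalue
        equation of \<open>u\<close> applies.\<close>
      have "x \<bullet>c (H *\<^sub>v b l) = (\<Sum>j<m. u $ j * ((H *\<^sub>v b (r + j)) \<bullet>c b l))"
        unfolding xy[OF Hc[OF bc[OF l]]] by (intro sum.cong refl) (simp add: herm bc l m(2))
      also have "\<dots> = (M *\<^sub>v u) $ i"
        using M i u by (auto simp: M_def scalar_prod_def lessThan_atLeast0 mult.commute intro!: sum.cong)
      also have "\<dots> = c * u $ i" unfolding Mu using i u by simp
      finally show ?thesis unfolding L R using x_high i by simp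
    qed
  qed
  have "x \<noteq> 0\<^sub>v n"
  proof
    assume "x = 0\<^sub>v n"
    then have "u $ i = 0" if "i < m" for i
      using x_high[OF that] bc[OF m(2)[OF that]] by simp
    then show False using u by (metis eq_vecI carrier_vecD index_zero_vec)
  qed
  then obtain d where d: "(d \<cdot>\<^sub>v x) \<bullet>c (d \<cdot>\<^sub>v x) = 1" using normalize_vec[OF x] by auto
  show ?thesis
  proof (rule that[of "d \<cdot>\<^sub>v x" c])
    show "(d \<cdot>\<^sub>v x) \<bullet>c v i = 0" if "i < r" for i
      using x_low[OF that] cinner_smult_left[OF x bc, of i] bv that r by simp
    show "H *\<^sub>v (d \<cdot>\<^sub>v x) = c \<cdot>\<^sub>v (d \<cdot>\<^sub>v x)"
      using Hx H x by (simp add: mult_mat_vec smult_smult_assoc mult.commute)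
  qed (use d x in auto)
qed

text \<open>The spectral theorem, gathering eigenvectors one at a time from the empty family. The
  \<open>\<mu> i\<close> stay complex here; for \<open>mat_adjoint A * A\<close> they are later
  identified with squared norms.\<close>

lemma hermitian_eigenbasis:
  assumes H: "H \<in> carrier_mat n n"
    and herm: "\<And>x y. x \<in> carrier_vec n \<Longrightarrow> y \<in> carrier_vec n \<Longrightarrow> (H *\<^sub>v x) \<bullet>c y = x \<bullet>c (H *\<^sub>v y)"
  obtains v \<mu> where "orthonormal_family n n v" "\<And>i. i < n \<Longrightarrow> H *\<^sub>v v i = \<mu> i \<cdot>\<^sub>v v i"
proof -
  have "\<exists>v \<mu>. orthonormal_family n r v \<and> (\<forall>i<r. H *\<^sub>v v i = \<mu> i \<cdot>\<^sub>v v i)" if "r \<le> n" for r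
    using that
  proof (induction r)
    case 0
    show ?case unfolding orthonormal_family_def by simp
  next
    case (Suc r)
    then obtain v \<mu> where v: "orthonormal_family n r v" and eig: "\<And>i. i < r \<Longrightarrow> H *\<^sub>v v i = \<mu> i \<cdot>\<^sub>v v i"
      by auto
    obtain w c where w: "w \<in> carrier_vec n" "w \<bullet>c w = 1" "\<And>i. i < r \<Longrightarrow> w \<bullet>c v i = 0"
      and Hw: "H *\<^sub>v w = c \<cdot>\<^sub>v w"
      using hermitian_next_eigenvector[OF H herm v _ eig] Suc.prems by (metis Suc_le_eq)
    have "\<forall>i<Suc r. H *\<^sub>v (v(r := w)) i = (\<mu>(r := c)) i \<cdot>\<^sub>v (v(r := w)) i"
      using Hw eig by (simp add: less_Suc_eq)
    then show ?case using orthonormal_family_snoc[OF v w] by blast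
  qed
  then show ?thesis using that by blast
qed

text \<open>This links an eigenbasis to \<open>singular_values\<close>, which is defined through the
  roots of a characteristic polynomial. The matrix with columns \<open>v\<close> makes
  \<open>H\<close> similar to a diagonal matrix, which is in particular triangular.\<close>

lemma char_poly_orthonormal_eigenbasis:
  assumes H: "H \<in> carrier_mat n n" and v: "orthonormal_family n n v"
    and eig: "\<And>i. i < n \<Longrightarrow> H *\<^sub>v v i = \<mu> i \<cdot>\<^sub>v v i"
  shows "char_poly H = (\<Prod>a\<leftarrow>map \<mu> [0..<n]. [:- a, 1:])"
proof -
  define V where "V = mat n n (\<lambda>(a, l). v l $ a)"
  define D where "D = mat n n (\<lambda>(i, j). if i = j then \<mu> i else 0)"
  have V: "V \<in> carrier_mat n n" and D: "D \<in> carrier_mat n n" unfolding V_def D_def by auto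
  note V' = mat_adjoint_carrier[OF V]
  have unit: "mat_adjoint V * V = 1\<^sub>m n" "V * mat_adjoint V = 1\<^sub>m n"
    using unitary_group_columns[OF v] unfolding unitary_group_def V_def by auto
  have "H * V = V * D"
  proof (rule eq_matI)
    fix a l assume "a < dim_row (V * D)" "l < dim_col (V * D)"
    then have a: "a < n" and l: "l < n" using V D by auto
    have "col V l = v l" using orthonormal_familyD(1)[OF v l] l unfolding V_def by auto
    then have "(H * V) $$ (a, l) = (H *\<^sub>v v l) $ a" using H V a l by simp
    also have "\<dots> = \<mu> l * v l $ a" unfolding eig[OF l] using orthonormal_familyD(1)[OF v l] a by simp
    also have "\<dots> = (\<Sum>j<n. if j = l then v j $ a * \<mu> j else 0)" using l by simp
    also have "\<dots> = (\<Sum>j<n. v j $ a * (if j = l then \<mu> j else 0))" by (intro sum.cong) auto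
    also have "\<dots> = (V * D) $$ (a, l)"
      using V D a l by (auto simp: V_def D_def scalar_prod_def lessThan_atLeast0 intro!: sum.cong)
    finally show "(H * V) $$ (a, l) = (V * D) $$ (a, l)" .
  qed (use H V D in auto)
  then have "H = V * D * mat_adjoint V"
    using assoc_mult_mat[OF H V V'] unit(2) H by simp
  then have "similar_mat H D"
    using similar_mat_witI[OF unit(2,1) _ H D V V'] unfolding similar_mat_def by blast
  then have "char_poly H = char_poly D" by (rule char_poly_similar)
  also have "\<dots> = (\<Prod>a\<leftarrow>diag_mat D. [:- a, 1:])"
    by (rule char_poly_upper_triangular[OF D]) (auto simp: D_def)
  also have "diag_mat D = map \<mu> [0..<n]"
    unfolding diag_mat_def D_def by (auto intro!: nth_equalityI)
  finally show ?thesis .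
qed

lemma proots_linear_factors: "proots (\<Prod>a\<leftarrow>as. [:- a, 1:]) = mset (as :: complex list)"
proof (induction as)
  case (Cons a as)
  have "(\<Prod>a\<leftarrow>as. [:- a, 1:]) \<noteq> 0" by (auto simp: prod_list_zero_iff)
  then have "proots ([:- a, 1:] * (\<Prod>a\<leftarrow>as. [:- a, 1:])) = proots [:- a, 1:] + proots (\<Prod>a\<leftarrow>as. [:- a, 1:])"
    by (intro proots_mult) auto
  then show ?case using Cons by (simp del: mult_pCons_left)
qed simp

text \<open>For an eigenbasis \<open>v\<close> of \<open>mat_adjoint A * A\<close> the images
  \<open>A *\<^sub>v v i\<close> are pairwise orthogonal, and their squared norms are the
  eigenvalues. Normalizing the nonzero images and completing them gives \<open>u\<close>.\<close>

lemma singular_value_decomposition: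
  assumes A: "A \<in> carrier_mat n n"
  obtains u v where "orthonormal_family n n u" "orthonormal_family n n v"
    "\<And>i. i < n \<Longrightarrow> A *\<^sub>v v i = complex_of_real (singular_values A ! i) \<cdot>\<^sub>v u i"
    "\<And>i. i < n \<Longrightarrow> singular_values A ! i \<ge> 0"
    "\<And>i j. i \<le> j \<Longrightarrow> j < n \<Longrightarrow> singular_values A ! j \<le> singular_values A ! i"
proof -
  define H where "H = mat_adjoint A * A"
  note A' = mat_adjoint_carrier[OF A]
  have H: "H \<in> carrier_mat n n" unfolding H_def using A A' by simp
  have Ac: "A *\<^sub>v x \<in> carrier_vec n" if "x \<in> carrier_vec n" for x using A that by simp
  have HA: "(H *\<^sub>v x) \<bullet>c y = (A *\<^sub>v x) \<bullet>c (A *\<^sub>v y)" if "x \<in> carrier_vec n" "y \<in> carrier_vec n" for x y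
    using cinner_mat_adjoint[OF A' Ac that(2)] that
    unfolding H_def assoc_mult_mat_vec[OF A' A that(1)] mat_adjoint_adjoint[OF A] by simp
  have "(H *\<^sub>v x) \<bullet>c y = x \<bullet>c (H *\<^sub>v y)" if x: "x \<in> carrier_vec n" and y: "y \<in> carrier_vec n" for x y
  proof -
    have "(H *\<^sub>v y) \<bullet>c x = cnj ((H *\<^sub>v x) \<bullet>c y)"
      using HA[OF x y] HA[OF y x] cinner_commute[OF Ac[OF x] Ac[OF y]] by simp
    moreover have "x \<bullet>c (H *\<^sub>v y) = cnj ((H *\<^sub>v y) \<bullet>c x)"
      using H x y by (intro cinner_commute[of _ n]) auto
    ultimately show ?thesis by simp
  qed
  then obtain w \<mu> where w: "orthonormal_family n n w" and eig: "\<And>i. i < n \<Longrightarrow> H *\<^sub>v w i = \<mu> i \<cdot>\<^sub>v w i"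
    using hermitian_eigenbasis[OF H] by metis
  define \<sigma> where "\<sigma> = singular_values A"
  have "char_poly H = (\<Prod>a\<leftarrow>map \<mu> [0..<n]. [:- a, 1:])"
    by (rule char_poly_orthonormal_eigenbasis[OF H w]) (rule eig)
  then have "proots (char_poly H) = mset (map \<mu> [0..<n])"
    by (simp only: proots_linear_factors)
  then have \<sigma>: "\<sigma> = rev (sorted_list_of_multiset (mset (map (\<lambda>i. sqrt (Re (\<mu> i))) [0..<n])))"
    unfolding \<sigma>_def singular_values_def H_def[symmetric] by (simp add: image_mset.compositionality o_def)
  then have mset: "mset \<sigma> = mset (map (\<lambda>i. sqrt (Re (\<mu> i))) [0..<n])" by simp
  have len: "length \<sigma> = n" using mset_eq_length[OF mset] by simp
  have "sorted (rev \<sigma>)" unfolding \<sigma> by simp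
  then have dec: "\<sigma> ! j \<le> \<sigma> ! i" if "i \<le> j" "j < n" for i j
    using that len by (simp add: sorted_rev_iff_nth_mono)
  \<comment> \<open>The definition sorts values and forgets eigenvectors; \<open>p\<close> recovers
    which eigenvector belongs to each place of the decreasing list.\<close>
  obtain p where p: "p permutes {..<n}" and "permute_list p (map (\<lambda>i. sqrt (Re (\<mu> i))) [0..<n]) = \<sigma>"
    using mset_eq_permutation[OF mset] by auto
  then have \<sigma>p: "\<sigma> ! i = sqrt (Re (\<mu> (p i)))" if "i < n" for i
    using that permute_list_nth[of p "map (\<lambda>i. sqrt (Re (\<mu> i))) [0..<n]" i] permutes_in_image[OF p, of i] by auto
  have pn: "p i < n" if "i < n" for i using permutes_in_image[OF p, of i] that by auto
  define v where "v = (\<lambda>i. w (p i))"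
  have v: "orthonormal_family n n v"
    using w pn permutes_inj[OF p] unfolding orthonormal_family_def v_def by (auto simp: inj_eq)
  note vc = orthonormal_familyD(1)[OF v]
  have AvAv: "(A *\<^sub>v v i) \<bullet>c (A *\<^sub>v v j) = (if i = j then \<mu> (p i) else 0)" if "i < n" "j < n" for i j
    using HA[OF vc[OF that(1)] vc[OF that(2)]] eig[OF pn[OF that(1)]]
      cinner_smult_left[OF vc[OF that(1)] vc[OF that(2)], of "\<mu> (p i)"] orthonormal_familyD(2)[OF v that]
    by (auto simp: v_def)
  \<comment> \<open>The eigenvalue is the squared norm of \<open>A *\<^sub>v v i\<close>, so it is
    real and nonnegative, and \<open>Re\<close> and \<open>sqrt\<close> in the definition lose
    nothing.\<close>
  have \<mu>: "\<mu> (p i) = complex_of_real ((\<sigma> ! i)\<^sup>2)" and nonneg: "\<sigma> ! i \<ge> 0" if i: "i < n" for i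
  proof -
    let ?s = "\<Sum>a<n. (cmod ((A *\<^sub>v v i) $ a))\<^sup>2"
    have s: "\<mu> (p i) = complex_of_real ?s"
      using AvAv[OF i i] cinner_self[OF Ac[OF vc[OF i]]] by simp
    have "?s \<ge> 0" by (intro sum_nonneg) simp
    moreover have "Re (\<mu> (p i)) = ?s" using s by simp
    ultimately show "\<mu> (p i) = complex_of_real ((\<sigma> ! i)\<^sup>2)" "\<sigma> ! i \<ge> 0"
      using s \<sigma>p[OF i] by simp_all
  qed
  \<comment> \<open>\<open>r\<close> counts the positive singular values, that is, it is the rank of
    \<open>A\<close>. The disjunct \<open>r = n\<close> covers the case that none is zero and keeps
    the search inside the list.\<close>
  define r where "r = (LEAST r. r = n \<or> \<sigma> ! r = 0)"
  have r: "r = n \<or> \<sigma> ! r = 0" unfolding r_def by (rule LeastI[of _ n]) simp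
  have rn: "r \<le> n" unfolding r_def by (rule Least_le) simp
  have pos: "\<sigma> ! i > 0" if "i < r" for i
    using not_less_Least[OF that[unfolded r_def]] nonneg[of i] that rn by auto
  have zero: "\<sigma> ! i = 0" if "r \<le> i" "i < n" for i
    using r dec[OF that] nonneg[OF that(2)] that by auto
  define f where "f = (\<lambda>i. complex_of_real (1 / \<sigma> ! i) \<cdot>\<^sub>v (A *\<^sub>v v i))"
  have "f i \<bullet>c f j = (if i = j then 1 else 0)" if i: "i < r" and j: "j < r" for i j
  proof -
    have "f i \<bullet>c f j = complex_of_real (1 / \<sigma> ! i) * (complex_of_real (1 / \<sigma> ! j) * ((A *\<^sub>v v i) \<bullet>c (A *\<^sub>v v j)))"
      unfolding f_def using Ac vc i j rn
      by (simp add: cinner_smult_left[of _ n] cinner_smult_right[of _ n])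
    also have "\<dots> = (if i = j then complex_of_real (1 / \<sigma> ! i * (1 / \<sigma> ! i * (\<sigma> ! i)\<^sup>2)) else 0)"
      using AvAv[of i j] \<mu>[of i] i j rn by (simp only: of_real_mult) auto
    also have "\<dots> = (if i = j then 1 else 0)" using pos[OF i] by (auto simp: power2_eq_square)
    finally show ?thesis .
  qed
  then have "orthonormal_family n r f"
    unfolding orthonormal_family_def using Ac vc rn by (auto simp: f_def)
  \<comment> \<open>From index \<open>r\<close> on any completion serves as left singular vectors,
    because both sides of the decomposition vanish there.\<close>
  then obtain u where u: "orthonormal_family n n u" and uf: "\<And>i. i < r \<Longrightarrow> u i = f i"
    using orthonormal_completion[OF _ rn] by metis
  have Av: "A *\<^sub>v v i = complex_of_real (\<sigma> ! i) \<cdot>\<^sub>v u i" if i: "i < n" for i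
  proof (cases "i < r")
    case True
    then show ?thesis using uf[OF True] pos[OF True] unfolding f_def by (simp add: smult_smult_assoc)
  next
    case False
    then have "(A *\<^sub>v v i) \<bullet>c (A *\<^sub>v v i) = 0" using AvAv[OF i i] \<mu>[OF i] zero[of i] i by simp
    then have "A *\<^sub>v v i = 0\<^sub>v n" using Ac[OF vc[OF i]] by simp
    then show ?thesis using zero[of i] False i orthonormal_familyD(1)[OF u i] by auto
  qed
  show ?thesis using that[OF u v] Av nonneg dec unfolding \<sigma>_def by blast
qed

section \<open>The Ky Fan inequality\<close>

text \<open>Compare with the threshold \<open>s (k - 1)\<close>, the smallest of the first
  \<open>k\<close> values: a total weight of at most \<open>k\<close> contributes at most
  \<open>k\<close> times the threshold, and only the first \<open>k\<close> indices can exceed it,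
  each with weight at most 1.\<close>

lemma weighted_sum_le_initial_sum:
  fixes s d :: "nat \<Rightarrow> real"
  assumes k: "1 \<le> k" "k \<le> n"
    and nonneg: "\<And>i. i < n \<Longrightarrow> 0 \<le> s i"
    and dec: "\<And>i j. i \<le> j \<Longrightarrow> j < n \<Longrightarrow> s j \<le> s i"
    and d: "\<And>i. i < n \<Longrightarrow> 0 \<le> d i" "\<And>i. i < n \<Longrightarrow> d i \<le> 1" "(\<Sum>i<n. d i) \<le> real k"
  shows "(\<Sum>i<n. s i * d i) \<le> (\<Sum>i<k. s i)"
proof -
  let ?t = "s (k - 1)"
  have "s i * d i \<le> ?t * d i + (if i < k then s i - ?t else 0)" if i: "i < n" for i
  proof (cases "i < k")
    case True
    then have "0 \<le> (s i - ?t) * (1 - d i)"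
      using dec[of i "k - 1"] k d(2)[OF i] by (intro mult_nonneg_nonneg) auto
    then show ?thesis using True by (simp add: algebra_simps)
  next
    case False
    then have "s i * d i \<le> ?t * d i"
      using dec[of "k - 1" i] i d(1)[OF i] by (intro mult_right_mono) auto
    then show ?thesis using False by simp
  qed
  then have "(\<Sum>i<n. s i * d i) \<le> (\<Sum>i<n. ?t * d i + (if i < k then s i - ?t else 0))"
    by (intro sum_mono) auto
  also have "\<dots> = ?t * (\<Sum>i<n. d i) + (\<Sum>i<n. if i < k then s i - ?t else 0)"
    by (simp add: sum.distrib sum_distrib_left)
  also have "(\<Sum>i<n. if i < k then s i - ?t else 0) = (\<Sum>i<k. s i - ?t)"
    using k(2) by (intro sum.mono_neutral_cong_right) auto
  \<comment> \<open>Enlarging the total weight to \<open>k\<close> is justified by the nonnegativity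
    of the threshold.\<close>
  also have "?t * (\<Sum>i<n. d i) \<le> ?t * real k"
    using d(3) nonneg[of "k - 1"] k by (intro mult_left_mono) auto
  finally show ?thesis by (simp add: sum_subtractf mult.commute)
qed

lemma cmod_cinner_commute:
  assumes "x \<in> carrier_vec n" "y \<in> carrier_vec n"
  shows "cmod (x \<bullet>c y) = cmod (y \<bullet>c x)"
  by (subst cinner_commute[OF assms]) (simp only: complex_mod_cnj)

lemma ky_fan_inequality:
  assumes A: "A \<in> carrier_mat n n" and k: "1 \<le> k" "k \<le> n"
    and x: "orthonormal_family n k x" and y: "orthonormal_family n k y"
  shows "cmod (\<Sum>i<k. (A *\<^sub>v x i) \<bullet>c y i) \<le> ky_fan_norm k A"
proof -
  obtain u v where u: "orthonormal_family n n u" and v: "orthonormal_family n n v"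
    and Av: "\<And>i. i < n \<Longrightarrow> A *\<^sub>v v i = complex_of_real (singular_values A ! i) \<cdot>\<^sub>v u i"
    and nonneg: "\<And>i. i < n \<Longrightarrow> singular_values A ! i \<ge> 0"
    and dec: "\<And>i j. i \<le> j \<Longrightarrow> j < n \<Longrightarrow> singular_values A ! j \<le> singular_values A ! i"
    using singular_value_decomposition[OF A] by metis
  let ?s = "\<lambda>l. singular_values A ! l"
  note uc = orthonormal_familyD(1)[OF u] and vc = orthonormal_familyD(1)[OF v]
    and xc = orthonormal_familyD(1)[OF x] and yc = orthonormal_familyD(1)[OF y]
  define p where "p = (\<lambda>i l. cmod (x i \<bullet>c v l))"
  define q where "q = (\<lambda>i l. cmod (y i \<bullet>c u l))"
  \<comment> \<open>\<open>d l\<close> is the weight left on the \<open>l\<close>-th singular value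
    once each product \<open>p i l * q i l\<close> is bounded by the mean of the squares.\<close>
  define d where "d = (\<lambda>l. \<Sum>i<k. ((p i l)\<^sup>2 + (q i l)\<^sup>2) / 2)"
  \<comment> \<open>\<open>A\<close> is moved across as its adjoint before the expansion along
    \<open>v\<close>, and back afterwards, so that only its values on the \<open>v l\<close>
    enter.\<close>
  have expand: "(A *\<^sub>v x i) \<bullet>c y i = (\<Sum>l<n. complex_of_real (?s l) * ((x i \<bullet>c v l) * (u l \<bullet>c y i)))"
    if i: "i < k" for i
  proof -
    have A'y: "mat_adjoint A *\<^sub>v y i \<in> carrier_vec n"
      using mat_adjoint_carrier[OF A] yc[OF i] by simp
    have "(A *\<^sub>v x i) \<bullet>c y i = (\<Sum>l<n. (x i \<bullet>c v l) * (v l \<bullet>c (mat_adjoint A *\<^sub>v y i)))"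
      using cinner_mat_adjoint[OF A xc[OF i] yc[OF i]] parseval[OF v xc[OF i] A'y] by simp
    also have "\<dots> = (\<Sum>l<n. (x i \<bullet>c v l) * (complex_of_real (?s l) * (u l \<bullet>c y i)))"
    proof (intro sum.cong refl)
      fix l assume "l \<in> {..<n}"
      then have l: "l < n" by simp
      show "(x i \<bullet>c v l) * (v l \<bullet>c (mat_adjoint A *\<^sub>v y i))
          = (x i \<bullet>c v l) * (complex_of_real (?s l) * (u l \<bullet>c y i))"
        using cinner_mat_adjoint[OF A vc[OF l] yc[OF i]] Av[OF l] cinner_smult_left[OF uc[OF l] yc[OF i]]
        by simp
    qed
    finally show ?thesis by (simp add: mult.left_commute)
  qed
  have "cmod (\<Sum>i<k. (A *\<^sub>v x i) \<bullet>c y i) \<le> (\<Sum>i<k. \<Sum>l<n. ?s l * (((p i l)\<^sup>2 + (q i l)\<^sup>2) / 2))"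
  proof (intro sum_norm_le)
    fix i assume "i \<in> {..<k}"
    then have i: "i < k" by simp
    show "cmod ((A *\<^sub>v x i) \<bullet>c y i) \<le> (\<Sum>l<n. ?s l * (((p i l)\<^sup>2 + (q i l)\<^sup>2) / 2))"
      unfolding expand[OF i]
    proof (intro sum_norm_le)
      fix l assume "l \<in> {..<n}"
      then have l: "l < n" by simp
      have "cmod (complex_of_real (?s l) * ((x i \<bullet>c v l) * (u l \<bullet>c y i))) = ?s l * (p i l * q i l)"
        unfolding p_def q_def cmod_cinner_commute[OF yc[OF i] uc[OF l]]
        using nonneg[OF l] by (simp add: norm_mult)
      moreover have "p i l * q i l \<le> ((p i l)\<^sup>2 + (q i l)\<^sup>2) / 2"
        using sum_squares_bound[of "p i l" "q i l"] by simp
      ultimately show "cmod (complex_of_real (?s l) * ((x i \<bullet>c v l) * (u l \<bullet>c y i)))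
          \<le> ?s l * (((p i l)\<^sup>2 + (q i l)\<^sup>2) / 2)"
        using nonneg[OF l] mult_left_mono by metis
    qed
  qed
  also have "\<dots> = (\<Sum>l<n. ?s l * d l)"
    unfolding d_def by (subst sum.swap) (simp add: sum_distrib_left)
  also have "\<dots> \<le> (\<Sum>l<k. ?s l)"
  proof (rule weighted_sum_le_initial_sum[OF k nonneg dec])
    fix l assume l: "l < n"
    show "0 \<le> d l" unfolding d_def by (intro sum_nonneg) simp
    \<comment> \<open>For fixed \<open>l\<close>, Bessel is applied to the families \<open>x\<close>
      and \<open>y\<close> and the unit vectors \<open>v l\<close> and \<open>u l\<close>.\<close>
    have "(\<Sum>i<k. (p i l)\<^sup>2) \<le> 1"
      using bessel[OF x k(2) vc[OF l]] orthonormal_familyD(2)[OF v l l]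
        cmod_cinner_commute[OF xc vc[OF l]] unfolding p_def by simp
    moreover have "(\<Sum>i<k. (q i l)\<^sup>2) \<le> 1"
      using bessel[OF y k(2) uc[OF l]] orthonormal_familyD(2)[OF u l l]
        cmod_cinner_commute[OF yc uc[OF l]] unfolding q_def by simp
    ultimately show "d l \<le> 1" unfolding d_def by (simp add: sum_divide_distrib[symmetric] sum.distrib)
  next
    \<comment> \<open>For the total the roles are exchanged: Bessel is applied to the bases
      \<open>v\<close> and \<open>u\<close> and the unit vectors \<open>x i\<close> and
      \<open>y i\<close>.\<close>
    have "(\<Sum>l<n. d l) = (\<Sum>i<k. ((\<Sum>l<n. (p i l)\<^sup>2) + (\<Sum>l<n. (q i l)\<^sup>2)) / 2)"
      unfolding d_def by (subst sum.swap) (simp add: sum_divide_distrib[symmetric] sum.distrib)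
    also have "\<dots> \<le> (\<Sum>i<k. 1)"
    proof (intro sum_mono)
      fix i assume "i \<in> {..<k}"
      then have i: "i < k" by simp
      have "(\<Sum>l<n. (p i l)\<^sup>2) \<le> 1" "(\<Sum>l<n. (q i l)\<^sup>2) \<le> 1"
        unfolding p_def q_def
        using bessel[OF v order_refl xc[OF i]] orthonormal_familyD(2)[OF x i i]
          bessel[OF u order_refl yc[OF i]] orthonormal_familyD(2)[OF y i i] by simp_all
      then show "((\<Sum>l<n. (p i l)\<^sup>2) + (\<Sum>l<n. (q i l)\<^sup>2)) / 2 \<le> 1" by simp
    qed
    finally show "(\<Sum>l<n. d l) \<le> real k" by simp
  qed
  finally show ?thesis unfolding ky_fan_norm_def .
qed

section \<open>Attainment of the discrepancy seminorm\<close>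

lemma mod_Suc_eq_iff:
  fixes i j n :: nat
  assumes "i < n" "j < n"
  shows "Suc i mod n = Suc j mod n \<longleftrightarrow> i = j"
  using assms by (auto simp: mod_Suc)

text \<open>The shift is cyclic, so it permutes the whole basis and also serves for
  \<open>k = n\<close>. A basis of one vector would be shifted to itself, hence
  \<open>2 \<le> n\<close>.\<close>

lemma orthonormal_family_shift:
  assumes u: "orthonormal_family n n u" and n: "2 \<le> n"
  shows "orthonormal_family n n (\<lambda>i. u (Suc i mod n))"
    and "i < n \<Longrightarrow> u (Suc i mod n) \<bullet>c u i = 0"
proof -
  have m: "Suc i mod n < n" for i using n by simp
  show "orthonormal_family n n (\<lambda>i. u (Suc i mod n))"
    using orthonormal_familyD[OF u] m
    unfolding orthonormal_family_def by (simp add: mod_Suc_eq_iff)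
  show "u (Suc i mod n) \<bullet>c u i = 0" if "i < n"
    using orthonormal_familyD(2)[OF u m that, of i] that n by (auto simp: mod_Suc split: if_splits)
qed

lemma orthonormal_family_mono:
  "orthonormal_family n m x \<Longrightarrow> k \<le> m \<Longrightarrow> orthonormal_family n k x"
  unfolding orthonormal_family_def by auto

lemma orthonormal_family_unit_vec: "orthonormal_family n n (unit_vec n :: nat \<Rightarrow> complex vec)"
  unfolding orthonormal_family_def by (auto simp: cinner_unit_vec)

text \<open>This keeps the coordinates of orthonormal families in a bounded region, for the
  compactness argument.\<close>

lemma cmod_entry_le_1:
  assumes x: "x \<in> carrier_vec n" "x \<bullet>c x = 1" and a: "a < n"
  shows "cmod (x $ a) \<le> 1"
proof -
  have "(\<Sum>b<n. (cmod (x $ b))\<^sup>2) = 1"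
    using cinner_self[OF x(1)] x(2) by (metis of_real_eq_1_iff)
  moreover have "(cmod (x $ a))\<^sup>2 \<le> (\<Sum>b<n. (cmod (x $ b))\<^sup>2)"
    using a by (intro member_le_sum) auto
  ultimately show ?thesis by (simp add: abs_square_le_1)
qed

definition discrepancy_feasible :: "nat \<Rightarrow> nat \<Rightarrow> (nat \<Rightarrow> complex vec) \<Rightarrow> (nat \<Rightarrow> complex vec) \<Rightarrow> bool" where
  "discrepancy_feasible n k x y \<longleftrightarrow>
    orthonormal_family n k x \<and> orthonormal_family n k y \<and> (\<Sum>j<k. x j \<bullet>c y j) = 0"

text \<open>The constraint holds because every summand vanishes. Such pairs show that the maximum is
  over a nonempty set, and later they realize the Ky Fan norm.\<close>

lemma discrepancy_feasible_shift:
  assumes "orthonormal_family n n u" "2 \<le> n" "k \<le> n"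
  shows "discrepancy_feasible n k (\<lambda>i. u (Suc i mod n)) u"
  using orthonormal_family_shift[OF assms(1,2)] assms
  unfolding discrepancy_feasible_def by (auto intro: orthonormal_family_mono)

text \<open>
  A pair of families is encoded by the array of all its coordinates, the \<^typ>\<open>bool\<close> selecting
  one of the two families; the product topology then provides compactness.
\<close>

lemma discrepancy_maximum_exists:
  assumes B: "B \<in> carrier_mat n n" and n: "2 \<le> n" and k: "k \<le> n"
  obtains x y where "discrepancy_feasible n k x y"
    "\<And>x' y'. discrepancy_feasible n k x' y' \<Longrightarrow>
      cmod (\<Sum>j<k. (B *\<^sub>v x' j) \<bullet>c y' j) \<le> cmod (\<Sum>j<k. (B *\<^sub>v x j) \<bullet>c y j)"
proof -
  define fam :: "(bool \<times> nat \<times> nat \<Rightarrow> complex) \<Rightarrow> bool \<Rightarrow> nat \<Rightarrow> complex vec"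
    where "fam = (\<lambda>f b j. vec n (\<lambda>a. f (b, j, a)))"
  define S where "S = {f. discrepancy_feasible n k (fam f True) (fam f False)}"
  \<comment> \<open>A compact square containing the closed unit disc; \<open>K\<close> confines
    every coordinate to it, including those with indices beyond \<open>k\<close> and
    \<open>n\<close>.\<close>
  define D where "D = (\<lambda>(a, b). Complex a b) ` ({-1..1} \<times> {-1..1})"
  define K where "K = (\<Pi>\<^sub>E t\<in>UNIV. D) \<inter> S"
  define val where "val = (\<lambda>f. cmod (\<Sum>j<k. (B *\<^sub>v fam f True j) \<bullet>c fam f False j))"
  have fam: "fam f b j \<in> carrier_vec n" for f b j unfolding fam_def by simp
  have ip: "fam f b i \<bullet>c fam f c j = (\<Sum>a<n. f (b, i, a) * cnj (f (c, j, a)))" for f b c i j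
    unfolding cinner_eq_sum[OF fam fam] by (simp add: fam_def)
  have coord: "continuous_on UNIV (\<lambda>f :: bool \<times> nat \<times> nat \<Rightarrow> complex. f t)" for t by simp
  \<comment> \<open>\<open>S\<close> is cut out by equations between continuous functions of the
    coordinates, hence closed.\<close>
  have "S = (\<Inter>b. \<Inter>i\<in>{..<k}. \<Inter>j\<in>{..<k}. {f. fam f b i \<bullet>c fam f b j = (if i = j then 1 else 0)})
      \<inter> {f. (\<Sum>j<k. fam f True j \<bullet>c fam f False j) = 0}"
    unfolding S_def discrepancy_feasible_def orthonormal_family_def
    by (auto simp: fam all_bool_eq) (metis (full_types))+
  also have "closed \<dots>"
    unfolding ip
    by (intro closed_Int closed_INT ballI closed_Collect_eq continuous_intros coord)
  finally have "closed S" .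
  have "compact D"
    unfolding D_def case_prod_beta
    by (intro compact_continuous_image continuous_intros compact_Times compact_Icc)
  \<comment> \<open>Tychonoff's theorem for a product over infinitely many index triples.\<close>
  then have "compact (\<Pi>\<^sub>E t\<in>(UNIV :: (bool \<times> nat \<times> nat) set). D)"
    using compactin_PiE[of "\<lambda>_ :: bool \<times> nat \<times> nat. euclidean :: complex topology" UNIV "\<lambda>_. D"]
    by (simp add: euclidean_product_topology)
  then have "compact K" unfolding K_def using \<open>closed S\<close> by (rule compact_Int_closed)
  have encode: "\<exists>f\<in>K. val f = cmod (\<Sum>j<k. (B *\<^sub>v x j) \<bullet>c y j)"
    if feas: "discrepancy_feasible n k x y" for x y
  proof -
    have x: "orthonormal_family n k x" and y: "orthonormal_family n k y"
      and xy: "(\<Sum>j<k. x j \<bullet>c y j) = 0"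
      using feas unfolding discrepancy_feasible_def by auto
    \<comment> \<open>Coordinates out of range get the default 0, which lies in \<open>D\<close>;
      neither the feasibility conditions nor \<open>val\<close> read them.\<close>
    define f where "f = (\<lambda>(b, j, a). if j < k \<and> a < n then (if b then x j else y j) $ a else 0)"
    have fx: "fam f True j = x j" and fy: "fam f False j = y j" if "j < k" for j
      using orthonormal_familyD(1)[OF x that] orthonormal_familyD(1)[OF y that] that
      by (auto simp: fam_def f_def)
    have "z \<in> D" if "cmod z \<le> 1" for z
      unfolding D_def using abs_Re_le_cmod[of z] abs_Im_le_cmod[of z] that
      by (intro image_eqI[of _ _ "(Re z, Im z)"]) auto
    moreover have "cmod (f t) \<le> 1" for t
      using cmod_entry_le_1[OF orthonormal_familyD(1)[OF x]] orthonormal_familyD(2)[OF x]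
        cmod_entry_le_1[OF orthonormal_familyD(1)[OF y]] orthonormal_familyD(2)[OF y]
      by (cases t) (auto simp: f_def)
    moreover have "f \<in> S"
      unfolding S_def mem_Collect_eq using x y xy fx fy
      unfolding discrepancy_feasible_def orthonormal_family_def by simp
    ultimately have "f \<in> K" unfolding K_def by auto
    moreover have "val f = cmod (\<Sum>j<k. (B *\<^sub>v x j) \<bullet>c y j)" unfolding val_def using fx fy by simp
    ultimately show ?thesis by blast
  qed
  \<comment> \<open>Written out, \<open>val\<close> is the modulus of a polynomial in the
    coordinates and their conjugates, hence continuous.\<close>
  have "val f = cmod (\<Sum>j<k. \<Sum>a<n. (\<Sum>c<n. B $$ (a, c) * f (True, j, c)) * cnj (f (False, j, a)))" for f
  proof -
    have "B *\<^sub>v fam f True j \<in> carrier_vec n" for j using B fam by simp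
    then have "(B *\<^sub>v fam f True j) \<bullet>c fam f False j
        = (\<Sum>a<n. (\<Sum>c<n. B $$ (a, c) * f (True, j, c)) * cnj (f (False, j, a)))" for j
      using B by (auto simp: cinner_eq_sum[OF _ fam] fam_def scalar_prod_def lessThan_atLeast0 intro!: sum.cong)
    then show ?thesis unfolding val_def by simp
  qed
  moreover have "continuous_on K (\<lambda>f. cmod (\<Sum>j<k. \<Sum>a<n. (\<Sum>c<n. B $$ (a, c) * f (True, j, c)) * cnj (f (False, j, a))))"
    by (rule continuous_on_subset[of UNIV]) (intro continuous_intros coord, simp)
  ultimately have "continuous_on K val" by (simp add: fun_eq_iff[symmetric] cong: continuous_on_cong)
  moreover have "K \<noteq> {}"
    using encode[OF discrepancy_feasible_shift[OF orthonormal_family_unit_vec n k]] by blast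
  ultimately obtain f where f: "f \<in> K" and max: "\<And>g. g \<in> K \<Longrightarrow> val g \<le> val f"
    using continuous_attains_sup[OF \<open>compact K\<close>] by blast
  show ?thesis
  proof (rule that[of "fam f True" "fam f False"])
    show "discrepancy_feasible n k (fam f True) (fam f False)" using f unfolding K_def S_def by simp
    show "cmod (\<Sum>j<k. (B *\<^sub>v x' j) \<bullet>c y' j) \<le> cmod (\<Sum>j<k. (B *\<^sub>v fam f True j) \<bullet>c fam f False j)"
      if "discrepancy_feasible n k x' y'" for x' y'
      using encode[OF that] max unfolding val_def by metis
  qed
qed

text \<open>\<open>GREATEST\<close> has a determined value only if the maximum is attained, which
  the compactness argument supplies; from here on the seminorm can be used as a maximum.\<close>

lemma discrepancy_seminorm_attained:
  assumes B: "B \<in> carrier_mat n n" and n: "2 \<le> n" and k: "k \<le> n"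
  obtains x y where "discrepancy_feasible n k x y"
    "discrepancy_seminorm k B = cmod (\<Sum>j<k. (B *\<^sub>v x j) \<bullet>c y j)"
    "\<And>x' y'. discrepancy_feasible n k x' y' \<Longrightarrow>
      cmod (\<Sum>j<k. (B *\<^sub>v x' j) \<bullet>c y' j) \<le> discrepancy_seminorm k B"
proof -
  obtain x y where feas: "discrepancy_feasible n k x y"
    and max: "\<And>x' y'. discrepancy_feasible n k x' y' \<Longrightarrow>
      cmod (\<Sum>j<k. (B *\<^sub>v x' j) \<bullet>c y' j) \<le> cmod (\<Sum>j<k. (B *\<^sub>v x j) \<bullet>c y j)"
    using discrepancy_maximum_exists[OF B n k] by metis
  have "discrepancy_seminorm k B = (GREATEST r. \<exists>x y. discrepancy_feasible n k x y \<and>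
      r = cmod (\<Sum>j<k. (B *\<^sub>v x j) \<bullet>c y j))"
    unfolding discrepancy_seminorm_def discrepancy_feasible_def using B by (simp add: conj_assoc)
  also have "\<dots> = cmod (\<Sum>j<k. (B *\<^sub>v x j) \<bullet>c y j)"
    by (rule Greatest_equality) (use feas max in blast)+
  finally show ?thesis using that feas max by metis
qed

section \<open>Rotating by a unitary matrix\<close>

lemma mat_adjoint_mult:
  fixes A B :: "complex mat"
  assumes A: "A \<in> carrier_mat n n" and B: "B \<in> carrier_mat n n"
  shows "mat_adjoint (A * B) = mat_adjoint B * mat_adjoint A"
proof (rule eq_matI)
  note A' = mat_adjoint_carrier[OF A] and B' = mat_adjoint_carrier[OF B]
  have AB: "A * B \<in> carrier_mat n n" using A B by simp
  note AB' = mat_adjoint_carrier[OF AB]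
  show "dim_row (mat_adjoint (A * B)) = dim_row (mat_adjoint B * mat_adjoint A)"
    "dim_col (mat_adjoint (A * B)) = dim_col (mat_adjoint B * mat_adjoint A)"
    using A' B' AB' by auto
  fix i j assume "i < dim_row (mat_adjoint B * mat_adjoint A)" "j < dim_col (mat_adjoint B * mat_adjoint A)"
  then have i: "i < n" and j: "j < n" using A' B' by auto
  have "mat_adjoint (A * B) $$ (i, j) = cnj ((A * B) $$ (j, i))" by (rule mat_adjoint_index[OF AB i j])
  also have "\<dots> = (\<Sum>l<n. cnj (B $$ (l, i)) * cnj (A $$ (j, l)))"
    using A B i j by (simp add: scalar_prod_def lessThan_atLeast0 mult.commute)
  also have "\<dots> = (mat_adjoint B * mat_adjoint A) $$ (i, j)"
    using A' B' i j by (simp add: scalar_prod_def lessThan_atLeast0 mat_adjoint_index[OF A] mat_adjoint_index[OF B])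
  finally show "mat_adjoint (A * B) $$ (i, j) = (mat_adjoint B * mat_adjoint A) $$ (i, j)" .
qed

lemma unitary_group_mult_adjoint:
  assumes "V \<in> unitary_group n" "X \<in> unitary_group n"
  shows "V * mat_adjoint X \<in> unitary_group n"
proof -
  have V: "V \<in> carrier_mat n n" and X: "X \<in> carrier_mat n n"
    and VV: "mat_adjoint V * V = 1\<^sub>m n" and XX: "X * mat_adjoint X = 1\<^sub>m n"
    using assms unfolding unitary_group_def by auto
  note V' = mat_adjoint_carrier[OF V] and X' = mat_adjoint_carrier[OF X]
  have Q: "V * mat_adjoint X \<in> carrier_mat n n" using V X' by simp
  have "mat_adjoint (V * mat_adjoint X) * (V * mat_adjoint X) = X * mat_adjoint V * (V * mat_adjoint X)"
    unfolding mat_adjoint_mult[OF V X'] mat_adjoint_adjoint[OF X] ..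
  also have "\<dots> = X * ((mat_adjoint V * V) * mat_adjoint X)"
    using assoc_mult_mat[OF X V' Q] assoc_mult_mat[OF V' V X'] by simp
  also have "\<dots> = 1\<^sub>m n" unfolding VV using X' XX by simp
  finally show ?thesis
    using mat_mult_left_right_inverse[OF mat_adjoint_carrier[OF Q] Q] Q unfolding unitary_group_def by simp
qed

text \<open>With the bases as columns of \<open>X\<close> and \<open>V\<close>, take
  \<open>Q = V * mat_adjoint X\<close>: the adjoint sends \<open>x i\<close> to a standard unit
  vector, which \<open>V\<close> sends to \<open>v i\<close>.\<close>

lemma unitary_exchanging_orthonormal_bases:
  assumes x: "orthonormal_family n n x" and v: "orthonormal_family n n v"
  obtains Q where "Q \<in> unitary_group n" "\<And>i. i < n \<Longrightarrow> Q *\<^sub>v x i = v i"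
proof -
  let ?X = "mat n n (\<lambda>(a, l). x l $ a)" and ?V = "mat n n (\<lambda>(a, l). v l $ a)"
  have X: "?X \<in> carrier_mat n n" and V: "?V \<in> carrier_mat n n" by auto
  note X' = mat_adjoint_carrier[OF X]
  have "(?V * mat_adjoint ?X) *\<^sub>v x i = v i" if i: "i < n" for i
  proof -
    note xi = orthonormal_familyD(1)[OF x i] and vi = orthonormal_familyD(1)[OF v i]
    have "mat_adjoint ?X *\<^sub>v x i = unit_vec n i"
    proof (rule eq_vecI)
      fix l assume "l < dim_vec (unit_vec n i :: complex vec)"
      then have l: "l < n" by simp
      have "(mat_adjoint ?X *\<^sub>v x i) $ l = (\<Sum>a<n. cnj (x l $ a) * x i $ a)"
        using X' xi l by (auto simp: scalar_prod_def lessThan_atLeast0 mat_adjoint_index[OF X] intro!: sum.cong)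
      also have "\<dots> = x i \<bullet>c x l"
        using cinner_eq_sum[OF xi orthonormal_familyD(1)[OF x l]] by (simp add: mult.commute)
      finally show "(mat_adjoint ?X *\<^sub>v x i) $ l = unit_vec n i $ l"
        using orthonormal_familyD(2)[OF x i l] i l by simp
    qed (use X' in simp)
    then have "(?V * mat_adjoint ?X) *\<^sub>v x i = ?V *\<^sub>v unit_vec n i"
      using assoc_mult_mat_vec[OF V X' xi] by simp
    also have "\<dots> = v i"
      using vi i by (intro eq_vecI) auto
    finally show ?thesis .
  qed
  then show ?thesis
    using that unitary_group_mult_adjoint[OF unitary_group_columns[OF v] unitary_group_columns[OF x]] by blast
qed

text \<open>A unitary matrix preserves inner products. Thus a rotation can be absorbed into the
  family \<open>x\<close>, and a bound for \<open>A\<close> covers \<open>A * Q\<close>.\<close>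

lemma orthonormal_family_unitary:
  assumes "Q \<in> unitary_group n" and x: "orthonormal_family n k x"
  shows "orthonormal_family n k (\<lambda>i. Q *\<^sub>v x i)"
proof -
  have Q: "Q \<in> carrier_mat n n" and QQ: "mat_adjoint Q * Q = 1\<^sub>m n"
    using assms(1) unfolding unitary_group_def by auto
  note Q' = mat_adjoint_carrier[OF Q] and xc = orthonormal_familyD(1)[OF x]
  have "(Q *\<^sub>v x i) \<bullet>c (Q *\<^sub>v x j) = x i \<bullet>c x j" if "i < k" "j < k" for i j
  proof -
    have "(Q *\<^sub>v x i) \<bullet>c (Q *\<^sub>v x j) = x i \<bullet>c (mat_adjoint Q *\<^sub>v (Q *\<^sub>v x j))"
      using Q xc that by (intro cinner_mat_adjoint) auto
    also have "mat_adjoint Q *\<^sub>v (Q *\<^sub>v x j) = x j"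
      using assoc_mult_mat_vec[OF Q' Q xc[OF that(2)]] xc[OF that(2)] unfolding QQ by simp
    finally show ?thesis .
  qed
  then show ?thesis
    using orthonormal_familyD[OF x] Q unfolding orthonormal_family_def by simp
qed

theorem mainTheorem1:
  fixes n k :: nat and A :: "complex mat"
  assumes "n \<ge> 2" and "A \<in> carrier_mat n n" and "1 \<le> k" and "k \<le> n"
  shows "is_maximum {discrepancy_seminorm k (A * Q) | Q. Q \<in> unitary_group n} (ky_fan_norm k A)"
proof -
  note n = assms(1) and A = assms(2) and k = assms(3,4)
  have upper: "discrepancy_seminorm k (A * Q) \<le> ky_fan_norm k A" if Q: "Q \<in> unitary_group n" for Q
  proof -
    have Qc: "Q \<in> carrier_mat n n" using Q unfolding unitary_group_def by simp
    have "A * Q \<in> carrier_mat n n" using A Qc by simp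
    then obtain x y where feas: "discrepancy_feasible n k x y"
      and eq: "discrepancy_seminorm k (A * Q) = cmod (\<Sum>j<k. ((A * Q) *\<^sub>v x j) \<bullet>c y j)"
      using discrepancy_seminorm_attained[OF _ n k(2)] by metis
    have x: "orthonormal_family n k x" and y: "orthonormal_family n k y"
      using feas unfolding discrepancy_feasible_def by auto
    have "discrepancy_seminorm k (A * Q) = cmod (\<Sum>j<k. (A *\<^sub>v (Q *\<^sub>v x j)) \<bullet>c y j)"
      unfolding eq using assoc_mult_mat_vec[OF A Qc orthonormal_familyD(1)[OF x]] by simp
    \<comment> \<open>The rotated pair may violate the zero-sum constraint, but
      \<open>ky_fan_inequality\<close> covers all pairs of orthonormal families.\<close>
    then show ?thesis
      using ky_fan_inequality[OF A k orthonormal_family_unitary[OF Q x] y] by simp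
  qed
  obtain u v where u: "orthonormal_family n n u" and v: "orthonormal_family n n v"
    and Av: "\<And>i. i < n \<Longrightarrow> A *\<^sub>v v i = complex_of_real (singular_values A ! i) \<cdot>\<^sub>v u i"
    and nonneg: "\<And>i. i < n \<Longrightarrow> singular_values A ! i \<ge> 0"
    using singular_value_decomposition[OF A] by metis
  let ?x = "\<lambda>i. u (Suc i mod n)"
  \<comment> \<open>With this \<open>Q\<close>, the product \<open>A * Q\<close> maps
    \<open>?x i\<close> to a multiple of \<open>u i\<close>, although \<open>?x i\<close> itself is
    orthogonal to \<open>u i\<close>.\<close>
  obtain Q where Q: "Q \<in> unitary_group n" and Qx: "\<And>i. i < n \<Longrightarrow> Q *\<^sub>v ?x i = v i"
    using unitary_exchanging_orthonormal_bases[OF orthonormal_family_shift(1)[OF u n] v] by metis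
  have Qc: "Q \<in> carrier_mat n n" using Q unfolding unitary_group_def by simp
  have AQ: "A * Q \<in> carrier_mat n n" using A Qc by simp
  have "((A * Q) *\<^sub>v ?x j) \<bullet>c u j = complex_of_real (singular_values A ! j)" if "j < k" for j
  proof -
    have j: "j < n" using that k by simp
    have "(A * Q) *\<^sub>v ?x j = complex_of_real (singular_values A ! j) \<cdot>\<^sub>v u j"
      using assoc_mult_mat_vec[OF A Qc orthonormal_familyD(1)[OF orthonormal_family_shift(1)[OF u n] j]]
        Qx[OF j] Av[OF j] by simp
    then show ?thesis
      using cinner_smult_left orthonormal_familyD[OF u] j by simp
  qed
  then have "(\<Sum>j<k. ((A * Q) *\<^sub>v ?x j) \<bullet>c u j) = complex_of_real (ky_fan_norm k A)"
    unfolding ky_fan_norm_def by simp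
  \<comment> \<open>Nonnegativity allows the modulus of the sum to be replaced by the norm
    itself.\<close>
  moreover have "ky_fan_norm k A \<ge> 0"
    unfolding ky_fan_norm_def using nonneg k by (intro sum_nonneg) auto
  ultimately have "cmod (\<Sum>j<k. ((A * Q) *\<^sub>v ?x j) \<bullet>c u j) = ky_fan_norm k A" by simp
  then have "ky_fan_norm k A \<le> discrepancy_seminorm k (A * Q)"
    using discrepancy_seminorm_attained[OF AQ n k(2)] discrepancy_feasible_shift[OF u n k(2)] by metis
  then have "discrepancy_seminorm k (A * Q) = ky_fan_norm k A" using upper[OF Q] by simp
  then show ?thesis unfolding is_maximum_def using Q upper by (auto intro: sym)
qed

end
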